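(* Let $n\geq 3$ and let $\Omega_d$ be an orbit of minimal driver sets for the cycle graph $C_n$ with $d\geq 3$. Then $\Omega_d$ is not strongly $\mathrm{Sym}_0(C_n)$-controllable, i.e. for $\{i,j\}\in\Omega_d$ the pair $(C_n,\{i,j\})$ is not strongly $\mathrm{Sym}_0(C_n)$-controllable.
   Context: $C_n$ is the simple undirected cycle graph with vertex set $V=\{1,\ldots,n\}$ and edge set $\{\{1,2\},\{2,3\},\ldots,\{n-1,n\},\{1,n\}\}$, and $d(i,j)$ is the usual graph distance. For $d\in\{1,\ldots,\lfloor n/2\rfloor\}$, $\Omega_d=\{\{i,j\}\subseteq V : i\neq j,\ d(i,j)=d\}$; it is an orbit of 2-subsets of $V$ under the automorphism group of $C_n$. For a simple undirected graph $G=(V,E)$ on $V=\{1,\ldots,n\}$ with (0-1) adjacency matrix $A$ and a non-empty subset $S=\{i_1,\ldots,i_k\}\subseteq V$, $B_S$ denotes the $(n\times k)$-matrix with columns the standard basis vectors $\mathbf{e}_{i_1},\ldots,\mathbf{e}_{i_k}$. A pair $(X,B)$ is controllable if the linear system $\dot{\mathbf{x}}=X\mathbf{x}+B\mathbf{u}$ is controllable. $S$ is a driver set for $G$ if $(A,B_S)$ is controllable; a minimal driver set is a driver set of minimum cardinality (for $C_n$ this minimum is $2$). "$\Omega_d$ is an orbit of minimal driver sets" means that its members are minimal driver sets. $\mathrm{Sym}_0(G)$ is the set of all real symmetric $(n\times n)$-matrices $X=[x_{ij}]$ with all diagonal entries equal to zero and such that for all $i\neq j$: $x_{ij}\neq 0$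 if and only if $\{i,j\}\in E$. $(G,S)$ is strongly $\mathrm{Sym}_0(G)$-controllable if $(X,B_S)$ is controllable for all $X\in \mathrm{Sym}_0(G)$; this property is invariant under applying automorphisms of $G$ to $S$. *)

theory Defs
  imports Complex_Main "HOL-Library.Extended_Nat" "Jordan_Normal_Form.Matrix"
begin

text \<open>A simple undirected graph with vertex set \<open>{1..n}\<close> is given by \<open>n\<close> and its set \<open>E\<close> of
  edges, which are 2-element subsets of \<open>{1..n}\<close>. Matrices and vectors are 0-indexed, so vertex
  \<open>i\<close> belongs to row and column \<open>i - 1\<close>.\<close>

definition cycle_edges :: "nat \<Rightarrow> nat set set" where
  "cycle_edges n = {{i, Suc i} | i. i \<in> {1..<n}} \<union> {{1, n}}"

definition walk :: "nat set set \<Rightarrow> nat \<Rightarrow> nat list \<Rightarrow> nat \<Rightarrow> bool" where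
  "walk E u p v \<longleftrightarrow>
    p \<noteq> [] \<and> hd p = u \<and> last p = v \<and> successively (\<lambda>a b. {a, b} \<in> E) p"

text \<open>The infimum of the empty set is \<open>\<infinity>\<close>, the distance between different components.\<close>

definition graph_dist :: "nat set set \<Rightarrow> nat \<Rightarrow> nat \<Rightarrow> enat" where
  "graph_dist E u v = (INF p \<in> {p. walk E u p v}. enat (length p - 1))"

definition Omega :: "nat \<Rightarrow> nat \<Rightarrow> nat set set" where
  "Omega n d = {{i, j} | i j. i \<in> {1..n} \<and> j \<in> {1..n} \<and> i \<noteq> j \<and>
                              graph_dist (cycle_edges n) i j = enat d}"

definition adjacency :: "nat \<Rightarrow> nat set set \<Rightarrow> real mat" where
  "adjacency n E = mat n n (\<lambda>(i, j). if {Suc i, Suc j} \<in> E then 1 else 0)"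

text \<open>The order of the columns is immaterial for controllability.\<close>

definition driver_mat :: "nat \<Rightarrow> nat set \<Rightarrow> real mat" where
  "driver_mat n S = mat_of_cols n (map (\<lambda>i. unit_vec n (i - 1)) (sorted_list_of_set S))"

text \<open>Continuous inputs \<open>u\<close> on the time interval from \<open>0\<close> to \<open>T\<close>, and classical solutions \<open>x\<close> of
  \<open>x' = X x + B u\<close>, both expressed componentwise.\<close>

definition admissible_input :: "real mat \<Rightarrow> real \<Rightarrow> (real \<Rightarrow> real vec) \<Rightarrow> bool" where
  "admissible_input B T u \<longleftrightarrow>
    (\<forall>t\<in>{0..T}. u t \<in> carrier_vec (dim_col B)) \<and>
    (\<forall>k<dim_col B. continuous_on {0..T} (\<lambda>t. u t $ k))"

definition trajectory ::
  "real mat \<Rightarrow> real mat \<Rightarrow> real \<Rightarrow> (real \<Rightarrow> real vec) \<Rightarrow> (real \<Rightarrow> real vec) \<Rightarrow> bool" where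
  "trajectory X B T u x \<longleftrightarrow>
    (\<forall>t\<in>{0..T}. x t \<in> carrier_vec (dim_row X)) \<and>
    (\<forall>i<dim_row X. \<forall>t\<in>{0..T}.
       ((\<lambda>s. x s $ i) has_real_derivative (X *\<^sub>v x t + B *\<^sub>v u t) $ i) (at t within {0..T}))"

definition controllable :: "real mat \<Rightarrow> real mat \<Rightarrow> bool" where
  "controllable X B \<longleftrightarrow>
    (\<forall>x0\<in>carrier_vec (dim_row X). \<forall>x1\<in>carrier_vec (dim_row X).
       \<exists>T>0. \<exists>u x. admissible_input B T u \<and> trajectory X B T u x \<and> x 0 = x0 \<and> x T = x1)"

definition driver_set :: "nat \<Rightarrow> nat set set \<Rightarrow> nat set \<Rightarrow> bool" where
  "driver_set n E S \<longleftrightarrow>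
    S \<noteq> {} \<and> S \<subseteq> {1..n} \<and> controllable (adjacency n E) (driver_mat n S)"

definition minimal_driver_set :: "nat \<Rightarrow> nat set set \<Rightarrow> nat set \<Rightarrow> bool" where
  "minimal_driver_set n E S \<longleftrightarrow>
    driver_set n E S \<and> (\<forall>S'. driver_set n E S' \<longrightarrow> card S \<le> card S')"

definition Sym0 :: "nat \<Rightarrow> nat set set \<Rightarrow> real mat set" where
  "Sym0 n E = {X \<in> carrier_mat n n. transpose_mat X = X \<and>
     (\<forall>i<n. X $$ (i, i) = 0) \<and>
     (\<forall>i<n. \<forall>j<n. i \<noteq> j \<longrightarrow> (X $$ (i, j) \<noteq> 0 \<longleftrightarrow> {Suc i, Suc j} \<in> E))}"

definition strongly_Sym0_controllable :: "nat \<Rightarrow> nat set set \<Rightarrow> nat set \<Rightarrow> bool" where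
  "strongly_Sym0_controllable n E S \<longleftrightarrow> (\<forall>X \<in> Sym0 n E. controllable X (driver_mat n S))"

end

theory Submission imports Defs begin

text \<open>A real left eigenvector \<open>v\<close> of \<open>X\<close> that annihilates \<open>B\<close> makes \<open>v \<bullet> x\<close> independent of the
  input, so the pair is not controllable. For \<open>S = {i, j}\<close> at distance at least 3, let \<open>v\<close> be \<open>0\<close> on
  \<open>S\<close>, \<open>1\<close> at the neighbours of \<open>S\<close> and \<open>sqrt 2\<close> elsewhere. Deleting \<open>S\<close> leaves two paths with at
  least two vertices each, and giving an edge \<open>{k, l}\<close> of such a path the weight \<open>1 / (v k * v l)\<close>
  makes the restriction of \<open>v\<close> an eigenvector for the eigenvalue \<open>1\<close>, because the inner vertices
  satisfy \<open>1 / v k + 1 / v k = v k\<close> and the end vertices \<open>1 / v k = v k\<close>. Weights \<open>1\<close> and \<open>-1\<close> on the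
  two edges at each vertex of \<open>S\<close> make the rows of \<open>S\<close> vanish on \<open>v\<close>.\<close>

text \<open>Along a trajectory the scalar \<open>g\<close> = \<open>v \<bullet> x\<close> solves g'
  = c * g. Started at the origin it stays zero, whereas at the target \<open>v\<close> it would be
  \<open>v \<bullet> v\<close> > 0.\<close>

lemma eigenvector_imp_not_controllable:
  fixes X B :: "real mat"
  assumes X: "X \<in> carrier_mat n n" and B: "B \<in> carrier_mat n m"
    and v: "v \<in> carrier_vec n" and nz: "v \<noteq> 0\<^sub>v n"
    and Xv: "transpose_mat X *\<^sub>v v = c \<cdot>\<^sub>v v" and Bv: "transpose_mat B *\<^sub>v v = 0\<^sub>v m"
  shows "\<not> controllable X B"
proof
  assume "controllable X B"
  then obtain T u x where T: "T > 0" and u: "admissible_input B T u"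
    and x: "trajectory X B T u x" and x0: "x 0 = 0\<^sub>v n" and xT: "x T = v"
    using X v unfolding controllable_def by (metis carrier_matD(1) zero_carrier_vec)
  define g where "g t = (\<Sum>i<n. v $ i * x t $ i)" for t
  have g: "(g has_real_derivative c * g t) (at t within {0..T})" if t: "t \<in> {0..T}" for t
  proof -
    have xt: "x t \<in> carrier_vec n" using x X t by (auto simp: trajectory_def)
    have ut: "u t \<in> carrier_vec m" using u B t by (auto simp: admissible_input_def)
    have "(g has_real_derivative (\<Sum>i<n. v $ i * (X *\<^sub>v x t + B *\<^sub>v u t) $ i)) (at t within {0..T})"
      unfolding g_def using x X t
      by (intro DERIV_sum DERIV_cmult) (auto simp: trajectory_def)
    also have "(\<Sum>i<n. v $ i * (X *\<^sub>v x t + B *\<^sub>v u t) $ i) = v \<bullet> (X *\<^sub>v x t + B *\<^sub>v u t)"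
      using X B by (simp add: scalar_prod_def atLeast0LessThan)
    also have "\<dots> = v \<bullet> (X *\<^sub>v x t) + v \<bullet> (B *\<^sub>v u t)"
      using X B xt ut v by (intro scalar_prod_add_distrib) auto
    also have "v \<bullet> (X *\<^sub>v x t) = (transpose_mat X *\<^sub>v v) \<bullet> x t"
      using transpose_vec_mult_scalar[OF X xt v] by simp
    also have "v \<bullet> (B *\<^sub>v u t) = (transpose_mat B *\<^sub>v v) \<bullet> u t"
      using transpose_vec_mult_scalar[OF B ut v] by simp
    also have "(transpose_mat X *\<^sub>v v) \<bullet> x t + (transpose_mat B *\<^sub>v v) \<bullet> u t = c * (v \<bullet> x t)"
      using xt ut v by (simp add: Xv Bv)
    also have "v \<bullet> x t = g t"
      using xt by (simp add: g_def scalar_prod_def atLeast0LessThan)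
    finally show ?thesis .
  qed
  \<comment> \<open>The integrating factor \<open>exp (- c * t)\<close> turns g' = c * g into h' =
    0.\<close>
  define h where "h t = g t * exp (- c * t)" for t
  have h: "(h has_real_derivative 0) (at t within {0..T})" if "t \<in> {0..T}" for t
    unfolding h_def by (auto intro!: derivative_eq_intros g[OF that])
  have "h T = h 0"
  proof (rule DERIV_isconst_end[OF T])
    show "continuous_on {0..T} h"
      using h by (meson DERIV_continuous continuous_on_eq_continuous_within)
    show "(h has_real_derivative 0) (at t)" if "0 < t" "t < T" for t
      using h[of t] that by (simp add: at_within_Icc_at)
  qed
  then have "g T = 0" by (simp add: h_def g_def x0)
  then have "v \<bullet> v = 0" using v by (simp add: g_def xT scalar_prod_def atLeast0LessThan)
  moreover obtain i where "i < n" "v $ i \<noteq> 0" using nz v by (auto simp: vec_eq_iff)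
  ultimately show False
    using v by (auto simp: scalar_prod_def sum_nonneg_eq_0_iff)
qed

lemma transpose_driver_mat_mult_vec:
  assumes v: "v \<in> carrier_vec n" and S: "finite S" "S \<subseteq> {1..n}"
    and zero: "\<And>i. i \<in> S \<Longrightarrow> v $ (i - 1) = 0"
  shows "transpose_mat (driver_mat n S) *\<^sub>v v = 0\<^sub>v (card S)"
proof (rule eq_vecI)
  fix k assume "k < dim_vec (0\<^sub>v (card S) :: real vec)"
  then have k: "k < length (sorted_list_of_set S)" by simp
  let ?i = "sorted_list_of_set S ! k"
  have "?i \<in> S" using k S by (metis nth_mem set_sorted_list_of_set)
  then have "?i - 1 < n" "v $ (?i - 1) = 0" using S zero by (auto simp: subset_iff)
  then show "(transpose_mat (driver_mat n S) *\<^sub>v v) $ k = 0\<^sub>v (card S) $ k"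
    using k v by (simp add: driver_mat_def)
qed (simp add: driver_mat_def)

lemma add_mod_neq:
  fixes k m n :: nat
  assumes "k < n" "0 < m" "m < n"
  shows "(k + m) mod n \<noteq> k"
  using assms by (cases "k + m < n") (auto simp: le_mod_geq)

text \<open>The closing edge \<open>{1, n}\<close> becomes an ordinary successor step modulo
  \<open>n\<close>, so later arguments need no case distinction at the seam.\<close>

lemma cycle_edges_iff:
  assumes "k < n" "l < n" "n \<ge> 2"
  shows "{Suc k, Suc l} \<in> cycle_edges n \<longleftrightarrow> l = Suc k mod n \<or> k = Suc l mod n"
proof -
  have "{Suc k, Suc l} \<in> cycle_edges n \<longleftrightarrow>
    (l = Suc k \<or> k = Suc l \<or> k = 0 \<and> Suc l = n \<or> l = 0 \<and> Suc k = n)"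
    using assms by (auto simp: cycle_edges_def doubleton_eq_iff)
  also have "\<dots> \<longleftrightarrow> l = Suc k mod n \<or> k = Suc l mod n"
    using assms by (auto simp: mod_Suc)
  finally show ?thesis .
qed

lemma graph_dist_le:
  assumes "walk E u p v"
  shows "graph_dist E u v \<le> enat (length p - 1)"
  unfolding graph_dist_def using assms by (intro INF_lower) simp

text \<open>\<open>m\<close> successor steps form a walk, and its reversal gives the second bound.
  Upper bounds suffice: distance at least 3 then means that at most two steps in either direction
  never join the two vertices.\<close>

lemma graph_dist_cycle_le:
  assumes "k < n" "n \<ge> 2"
  shows "graph_dist (cycle_edges n) (Suc k) (Suc ((k + m) mod n)) \<le> enat m"
    and "graph_dist (cycle_edges n) (Suc ((k + m) mod n)) (Suc k) \<le> enat m"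
proof -
  let ?E = "cycle_edges n"
  let ?p = "map (\<lambda>r. Suc ((k + r) mod n)) [0..<Suc m]"
  have edge: "{Suc ((k + r) mod n), Suc ((k + Suc r) mod n)} \<in> ?E" for r
    using assms by (subst cycle_edges_iff) (auto simp: mod_Suc_eq)
  have "successively (\<lambda>a b. {a, b} \<in> ?E) ?p"
    unfolding successively_conv_nth using edge by (auto simp del: upt_Suc simp flip: add_Suc_right)
  then have p: "walk ?E (Suc k) ?p (Suc ((k + m) mod n))"
    using assms by (simp add: walk_def hd_map last_map del: upt_Suc)
  then have p': "walk ?E (Suc ((k + m) mod n)) (rev ?p) (Suc k)"
    by (simp add: walk_def hd_rev last_rev insert_commute del: upt_Suc)
  from graph_dist_le[OF p] show "graph_dist ?E (Suc k) (Suc ((k + m) mod n)) \<le> enat m"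
    by (simp del: upt_Suc)
  from graph_dist_le[OF p'] show "graph_dist ?E (Suc ((k + m) mod n)) (Suc k) \<le> enat m"
    by (simp del: upt_Suc)
qed

text \<open>The hypothesis on \<open>R\<close> says that every gap between cyclically consecutive
  elements of \<open>R\<close> has at least two vertices, so no vertex has both neighbours in
  \<open>R\<close>.\<close>

lemma Sym0_cycle_eigenvector:
  fixes n :: nat and R :: "nat set"
  defines "s k \<equiv> Suc k mod n"
  assumes n: "n \<ge> 3"
    and R: "\<And>k. k \<in> R \<Longrightarrow> k < n \<and> s k \<notin> R \<and> s (s k) \<notin> R" and "R \<noteq> {}"
  obtains X v where "X \<in> Sym0 n (cycle_edges n)" "v \<in> carrier_vec n" "v \<noteq> 0\<^sub>v n"
    "X *\<^sub>v v = v" "\<And>k. k \<in> R \<Longrightarrow> v $ k = 0"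
proof -
  \<comment> \<open>The cyclic predecessor; adding \<open>n - 1\<close> avoids truncated subtraction
    at 0.\<close>
  define r where "r k = (k + (n - 1)) mod n" for k
  have s_lt: "s k < n" and r_lt: "r k < n" for k using n by (auto simp: s_def r_def)
  have sr: "s (r k) = k" if "k < n" for k
    using that by (simp add: s_def r_def mod_Suc_eq)
  have rs: "r (s k) = k" if "k < n" for k
  proof -
    have "r (s k) = (Suc k + (n - 1)) mod n" by (simp only: r_def s_def mod_add_left_eq)
    then show ?thesis using that by simp
  qed
  have ss: "s (s k) \<noteq> k" "s k \<noteq> k" if "k < n" for k
    using that n add_mod_neq[of k n 1] add_mod_neq[of k n 2] by (auto simp: s_def mod_Suc_eq)
  define f :: "nat \<Rightarrow> real" where
    "f k = (if k \<in> R then 0 else if s k \<in> R \<or> r k \<in> R then 1 else sqrt 2)" for k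
  \<comment> \<open>\<open>w k\<close> is the weight of the edge from \<open>k\<close> to
    \<open>s k\<close>. An element of \<open>R\<close> thus has weight 1 on its outgoing and -1 on
    its incoming edge.\<close>
  define w :: "nat \<Rightarrow> real" where
    "w k = (if k \<in> R then 1 else if s k \<in> R then -1 else 1 / (f k * f (s k)))" for k
  \<comment> \<open>As \<open>s (s k) \<noteq> k\<close>, at most one summand is nonzero, so no
    entry of an edge can cancel.\<close>
  define X where "X = mat n n (\<lambda>(k, l). (if l = s k then w k else 0) + (if k = s l then w l else 0))"
  define v where "v = vec n f"
  have w: "w k \<noteq> 0" for k by (auto simp: w_def f_def)
  have "X \<in> Sym0 n (cycle_edges n)"
  proof -
    have "X $$ (k, l) \<noteq> 0 \<longleftrightarrow> {Suc k, Suc l} \<in> cycle_edges n" if "k < n" "l < n" for k l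
      using that n w ss[of k] ss[of l] cycle_edges_iff[of k n l] by (auto simp: X_def s_def)
    moreover have "X $$ (k, k) = 0" if "k < n" for k
      using that ss[of k] by (auto simp: X_def)
    moreover have "transpose_mat X = X"
      by (rule eq_matI) (auto simp: X_def)
    ultimately show ?thesis by (auto simp: Sym0_def X_def)
  qed
  moreover have "v \<in> carrier_vec n" by (simp add: v_def)
  moreover have "v \<noteq> 0\<^sub>v n"
  proof -
    obtain k where "k \<in> R" using \<open>R \<noteq> {}\<close> by blast
    then have "f (s k) = 1" using R[of k] rs[of k] by (simp add: f_def)
    then have "v $ s k \<noteq> 0\<^sub>v n $ s k" using s_lt[of k] by (simp add: v_def)
    then show ?thesis by metis
  qed
  moreover have "X *\<^sub>v v = v"
  proof (rule eq_vecI)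
    fix k assume "k < dim_vec v"
    then have k: "k < n" by (simp add: v_def)
    have "(X *\<^sub>v v) $ k
        = (\<Sum>l<n. ((if l = s k then w k else 0) + (if k = s l then w l else 0)) * f l)"
      using k by (simp add: X_def v_def scalar_prod_def atLeast0LessThan)
    also have "\<dots> = (\<Sum>l<n. (if l = s k then w k * f l else 0) + (if l = r k then w l * f l else 0))"
    proof (intro sum.cong refl)
      fix l assume "l \<in> {..<n}"
      then have "k = s l \<longleftrightarrow> l = r k" using sr[OF k] rs[of l] by auto
      then show "((if l = s k then w k else 0) + (if k = s l then w l else 0)) * f l
          = (if l = s k then w k * f l else 0) + (if l = r k then w l * f l else 0)"
        by (simp add: distrib_right)
    qed
    also have "\<dots> = w k * f (s k) + w (r k) * f (r k)"
      using s_lt r_lt by (simp add: sum.distrib)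
    also have "\<dots> = f k"
    proof -
      have R1: "k \<in> R \<Longrightarrow> s k \<notin> R" "k \<in> R \<Longrightarrow> r k \<notin> R" "r k \<in> R \<Longrightarrow> s k \<notin> R"
        using R[of k] R[of "r k"] sr[OF k] by auto
      \<comment> \<open>On \<open>R\<close> the sum is 1 - 1 = 0. Next to \<open>R\<close> one term
        vanishes and the other is 1 / f k = 1. Elsewhere both are 1 / sqrt 2, with sum sqrt
        2.\<close>
      consider "k \<in> R" | "k \<notin> R" "s k \<in> R" | "k \<notin> R" "r k \<in> R" | "k \<notin> R" "s k \<notin> R" "r k \<notin> R"
        by blast
      then show ?thesis
        using R1 sr[OF k] rs[OF k]
        by cases (auto simp: w_def f_def field_simps real_sqrt_mult_self)
    qed
    finally show "(X *\<^sub>v v) $ k = v $ k" using k by (simp add: v_def)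
  qed (simp add: X_def v_def)
  moreover have "v $ k = 0" if "k \<in> R" for k
    using that R[OF that] by (simp add: v_def f_def)
  ultimately show ?thesis by (rule that)
qed

theorem theorem23:
  fixes n d :: nat
  assumes "n \<ge> 3"
    and "d \<in> {1..n div 2}"
    and "\<forall>S \<in> Omega n d. minimal_driver_set n (cycle_edges n) S"
    and "d \<ge> 3"
  shows "\<forall>S \<in> Omega n d. \<not> strongly_Sym0_controllable n (cycle_edges n) S"
proof
  fix S assume "S \<in> Omega n d"
  then obtain i j where S: "S = {i, j}" "S \<subseteq> {1..n}"
    and dist: "graph_dist (cycle_edges n) i j = enat d"
    by (auto simp: Omega_def)
  define p q where "p = i - 1" and "q = j - 1"
  have pq: "i = Suc p" "j = Suc q" "p < n" "q < n" using S by (auto simp: p_def q_def)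
  \<comment> \<open>The reversed bound at \<open>q\<close> again concerns the distance from
    \<open>i\<close> to \<open>j\<close>, so \<open>dist\<close> serves both directions.\<close>
  have "d \<le> m" if "(p + m) mod n = q \<or> (q + m) mod n = p" for m
    using that graph_dist_cycle_le(1)[of p n m] graph_dist_cycle_le(2)[of q n m] pq dist \<open>n \<ge> 3\<close>
    by auto
  then have far: "(p + m) mod n \<noteq> q" "(q + m) mod n \<noteq> p" if "m \<le> 2" for m
    using that \<open>d \<ge> 3\<close> by force+
  have "k < n \<and> Suc k mod n \<notin> {p, q} \<and> Suc (Suc k mod n) mod n \<notin> {p, q}" if "k \<in> {p, q}" for k
  proof -
    \<comment> \<open>Going around the cycle, \<open>k\<close> must also not return to itself within
      two steps; this is where \<open>n \<ge> 3\<close> enters.\<close>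
    have "(k + 1) mod n \<noteq> k" "(k + 2) mod n \<noteq> k"
      using that pq \<open>n \<ge> 3\<close> by (intro add_mod_neq; auto)+
    then show ?thesis
      using that far[of 1] far[of 2] pq by (auto simp: mod_Suc_eq)
  qed
  then obtain X v where X: "X \<in> Sym0 n (cycle_edges n)"
    and v: "v \<in> carrier_vec n" "v \<noteq> 0\<^sub>v n" "X *\<^sub>v v = v" "\<And>k. k \<in> {p, q} \<Longrightarrow> v $ k = 0"
    using Sym0_cycle_eigenvector[OF \<open>n \<ge> 3\<close>, of "{p, q}"] by blast
  have "\<not> controllable X (driver_mat n S)"
  proof (rule eigenvector_imp_not_controllable)
    show "X \<in> carrier_mat n n" and "transpose_mat X *\<^sub>v v = 1 \<cdot>\<^sub>v v"
      using X v by (auto simp: Sym0_def)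
    show "driver_mat n S \<in> carrier_mat n (card S)"
      by (intro carrier_matI) (simp_all add: driver_mat_def)
    show "transpose_mat (driver_mat n S) *\<^sub>v v = 0\<^sub>v (card S)"
      using v S by (intro transpose_driver_mat_mult_vec) (auto simp: p_def q_def)
  qed (fact v)+
  then show "\<not> strongly_Sym0_controllable n (cycle_edges n) S"
    using X by (auto simp: strongly_Sym0_controllable_def)
qed

end
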